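(* Let $\mathbb{M}=(V,\mathcal{C})$ be a simple binary matroid. Then the family of chordless circuits of $\mathbb{M}$ is the unique minimum-cardinality generator of $\mathcal{C}$.
   Context: A binary matroid is one representable over GF(2); simple means no loops and no parallel elements; $\mathcal{C}$ is the family of circuits. A circuit $C\in\mathcal{C}$ is chordless if there is no $C'\in\mathcal{C}$ with $|C'\setminus C|=1$ and $|C'|<|C|$. For $\mathcal{F}\subseteq 2^V$ and $\mathcal{G}\subseteq\mathcal{F}$, let $\langle\mathcal{G}\rangle^1_{\mathcal{F}}=\mathcal{G}\cup\{X\in\mathcal{F}: X=(X_1\cup X_2)\setminus\{v\}$ for distinct $X_1,X_2\in\mathcal{G}$ and $v\in X_1\cap X_2\}$, iterate this operator until it stabilizes, and call the final family $\langle\mathcal{G}\rangle_{\mathcal{F}}$; $\mathcal{G}$ is a generator of $\mathcal{F}$ if $\langle\mathcal{G}\rangle_{\mathcal{F}}=\mathcal{F}$. *)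

theory Defs
  imports Complex_Main "HOL-Library.Z2" "HOL-Library.Function_Algebras"
begin

section \<open>Matroids given by their circuits\<close>

locale matroid =
  fixes V :: "'a set" and \<C> :: "'a set set"
  assumes finite_ground: "finite V"
    and circuits_subset: "\<C> \<subseteq> Pow V"
    and empty_not_circuit: "{} \<notin> \<C>"
    and circuit_antichain: "\<And>C D. \<lbrakk>C \<in> \<C>; D \<in> \<C>; C \<subseteq> D\<rbrakk> \<Longrightarrow> C = D"
    and circuit_elimination:
      "\<And>C D v. \<lbrakk>C \<in> \<C>; D \<in> \<C>; C \<noteq> D; v \<in> C \<inter> D\<rbrakk> \<Longrightarrow> \<exists>E\<in>\<C>. E \<subseteq> (C \<union> D) - {v}"

definition indep :: "'a set \<Rightarrow> 'a set set \<Rightarrow> 'a set \<Rightarrow> bool" where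
  "indep V \<C> X \<longleftrightarrow> X \<subseteq> V \<and> \<not> (\<exists>C\<in>\<C>. C \<subseteq> X)"

definition loop :: "'a set set \<Rightarrow> 'a \<Rightarrow> bool" where
  "loop \<C> v \<longleftrightarrow> {v} \<in> \<C>"

definition parallel :: "'a set set \<Rightarrow> 'a \<Rightarrow> 'a \<Rightarrow> bool" where
  "parallel \<C> u v \<longleftrightarrow> u \<noteq> v \<and> {u, v} \<in> \<C>"

definition simple_matroid :: "'a set \<Rightarrow> 'a set set \<Rightarrow> bool" where
  "simple_matroid V \<C> \<longleftrightarrow> (\<forall>v\<in>V. \<not> loop \<C> v) \<and> (\<forall>u\<in>V. \<forall>v\<in>V. \<not> parallel \<C> u v)"


section \<open>Representability\<close>

definition fun_scale :: "'k::field \<Rightarrow> (nat \<Rightarrow> 'k) \<Rightarrow> nat \<Rightarrow> 'k" where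
  "fun_scale c x = (\<lambda>i. c * x i)"

interpretation fun_space: vector_space fun_scale
  by unfold_locales (auto simp: fun_scale_def fun_eq_iff algebra_simps)

text \<open>
  The space \<open>K\<^sup>r\<close> is the set of functions \<open>nat \<Rightarrow> K\<close> vanishing on all \<open>i \<ge> r\<close>. The vectors
  \<open>\<phi> v\<close> form an indexed family, so \<open>X\<close> is independent iff \<open>\<phi>\<close> is injective on \<open>X\<close> and the set of
  its values is linearly independent. The field is passed as a type argument.
\<close>
definition representable :: "'k::field itself \<Rightarrow> 'a set \<Rightarrow> 'a set set \<Rightarrow> bool" where
  "representable K V \<C> \<longleftrightarrow>
     (\<exists>r. \<exists>\<phi> :: 'a \<Rightarrow> nat \<Rightarrow> 'k.
        (\<forall>v\<in>V. \<forall>i\<ge>r. \<phi> v i = 0) \<and>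
        (\<forall>X\<subseteq>V. indep V \<C> X \<longleftrightarrow> inj_on \<phi> X \<and> fun_space.independent (\<phi> ` X)))"

definition binary_matroid :: "'a set \<Rightarrow> 'a set set \<Rightarrow> bool" where
  "binary_matroid V \<C> \<longleftrightarrow> representable TYPE(bit) V \<C>"


section \<open>Chordless circuits and generators\<close>

definition chordless :: "'a set set \<Rightarrow> 'a set \<Rightarrow> bool" where
  "chordless \<C> C \<longleftrightarrow> C \<in> \<C> \<and> \<not> (\<exists>C'\<in>\<C>. card (C' - C) = 1 \<and> card C' < card C)"

definition gen_step :: "'a set set \<Rightarrow> 'a set set \<Rightarrow> 'a set set" where
  "gen_step \<F> \<G> =
     \<G> \<union> {X \<in> \<F>. \<exists>X\<^sub>1\<in>\<G>. \<exists>X\<^sub>2\<in>\<G>. X\<^sub>1 \<noteq> X\<^sub>2 \<and> (\<exists>v \<in> X\<^sub>1 \<inter> X\<^sub>2. X = (X\<^sub>1 \<union> X\<^sub>2) - {v})}"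

text \<open>
  The iteration stops at the first \<open>n\<close> at which the family no longer changes; such an \<open>n\<close>
  exists for finite \<open>\<F>\<close> by \<open>gen_step_stabilizes\<close> below.
\<close>
definition generated :: "'a set set \<Rightarrow> 'a set set \<Rightarrow> 'a set set" where
  "generated \<F> \<G> =
     (gen_step \<F> ^^ (LEAST n. (gen_step \<F> ^^ Suc n) \<G> = (gen_step \<F> ^^ n) \<G>)) \<G>"

lemma gen_step_stabilizes:
  assumes "finite \<F>" "\<G> \<subseteq> \<F>"
  shows "\<exists>n. (gen_step \<F> ^^ Suc n) \<G> = (gen_step \<F> ^^ n) \<G>"
proof (rule ccontr)
  assume neq: "\<nexists>n. (gen_step \<F> ^^ Suc n) \<G> = (gen_step \<F> ^^ n) \<G>"
  have sub: "(gen_step \<F> ^^ n) \<G> \<subseteq> \<F>" for n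
    by (induction n) (use assms in \<open>auto simp: gen_step_def\<close>)
  have "card ((gen_step \<F> ^^ n) \<G>) < card ((gen_step \<F> ^^ Suc n) \<G>)" for n
  proof (rule psubset_card_mono)
    show "finite ((gen_step \<F> ^^ Suc n) \<G>)"
      using sub assms(1) by (rule finite_subset)
    have "(gen_step \<F> ^^ n) \<G> \<subseteq> (gen_step \<F> ^^ Suc n) \<G>"
      by (auto simp: gen_step_def)
    with neq show "(gen_step \<F> ^^ n) \<G> \<subset> (gen_step \<F> ^^ Suc n) \<G>"
      by blast
  qed
  then have "strict_mono (\<lambda>n. card ((gen_step \<F> ^^ n) \<G>))"
    by (rule strict_mono_Suc_iff[THEN iffD2, OF allI])
  then have "n \<le> card ((gen_step \<F> ^^ n) \<G>)" for n
    by (rule strict_mono_imp_increasing)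
  then have "Suc (card \<F>) \<le> card \<F>"
    using card_mono[OF assms(1) sub] le_trans by blast
  then show False by simp
qed

definition generator :: "'a set set \<Rightarrow> 'a set set \<Rightarrow> bool" where
  "generator \<F> \<G> \<longleftrightarrow> \<G> \<subseteq> \<F> \<and> generated \<F> \<G> = \<F>"

end

(* Circuits of a binary matroid are the minimal nonempty sets whose vectors sum to zero, so the
   symmetric difference of two distinct circuits contains a circuit. Hence if X, X1, X2 are
   circuits with X = (X1 \<union> X2) - {v} and v \<in> X1 \<inter> X2, then X is the symmetric difference of X1
   and X2, which meet in v only; as X1 and X2 have at least three elements, X1 shows that X is not
   chordless. So every generator contains all chordless circuits. Conversely, if C' witnesses that
   C is not chordless, then C is obtained from C' and the symmetric difference of C and C', which
   is again a circuit; both are smaller than C, and induction on the cardinality shows that the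
   chordless circuits generate. *)
theory Submission
  imports Defs
begin

section \<open>Zero sums over the two-element field\<close>

lemma fun_bit_add_self: "(x :: 'b \<Rightarrow> bit) + x = 0"
  by (simp add: fun_eq_iff)

lemma sum_sym_diff_bit:
  fixes \<phi> :: "'a \<Rightarrow> 'b \<Rightarrow> bit"
  assumes "finite A" "finite B"
  shows "sum \<phi> (sym_diff A B) = sum \<phi> A + sum \<phi> B"
proof -
  have A: "sum \<phi> A = sum \<phi> (A - B) + sum \<phi> (A \<inter> B)"
    using sum.Int_Diff[OF assms(1), of \<phi> B] by (simp add: add.commute)
  have B: "sum \<phi> B = sum \<phi> (B - A) + sum \<phi> (A \<inter> B)"
    using sum.Int_Diff[OF assms(2), of \<phi> A] by (simp add: add.commute Int_commute)
  have "sum \<phi> (sym_diff A B) = sum \<phi> (A - B) + sum \<phi> (B - A)"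
    using assms by (intro sum.union_disjoint) auto
  \<comment> \<open>The intersection enters twice, which is zero in characteristic 2.\<close>
  also have "\<dots> = sum \<phi> (A - B) + sum \<phi> (B - A) + (sum \<phi> (A \<inter> B) + sum \<phi> (A \<inter> B))"
    by (simp add: fun_bit_add_self)
  also have "\<dots> = sum \<phi> A + sum \<phi> B"
    by (simp only: A B add_ac)
  finally show ?thesis .
qed

lemma zero_sum_not_independent:
  fixes \<phi> :: "'a \<Rightarrow> nat \<Rightarrow> bit"
  assumes "finite X" "X \<noteq> {}" "sum \<phi> X = 0" "inj_on \<phi> X"
  shows "fun_space.dependent (\<phi> ` X)"
proof -
  \<comment> \<open>The constant coefficient 1 gives a nontrivial linear relation; injectivity lets
    the sum run over the image.\<close>
  have "(\<Sum>w\<in>\<phi> ` X. fun_scale 1 w) = 0"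
    using assms(3,4) by (simp add: sum.reindex)
  then show ?thesis
    using assms(1,2) by (subst fun_space.dependent_finite) (auto intro!: exI[of _ "\<lambda>_. 1"])
qed

text \<open>Coefficients over GF(2) are 0 or 1, so a linear relation is just the sum over its
  support. If \<phi> is not injective, two equal vectors already cancel.\<close>

lemma dependent_zero_sum_subset:
  fixes \<phi> :: "'a \<Rightarrow> nat \<Rightarrow> bit"
  assumes fin: "finite X" and dep: "\<not> (inj_on \<phi> X \<and> fun_space.independent (\<phi> ` X))"
  shows "\<exists>S\<subseteq>X. S \<noteq> {} \<and> sum \<phi> S = 0"
proof (cases "inj_on \<phi> X")
  case True
  with dep fin obtain u w where w: "w \<in> X" "u (\<phi> w) \<noteq> 0"
    and u: "(\<Sum>w\<in>\<phi> ` X. fun_scale (u w) w) = 0"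
    by (auto simp: fun_space.dependent_finite)
  have scale: "fun_scale (u (\<phi> x)) (\<phi> x) = (if u (\<phi> x) \<noteq> 0 then \<phi> x else 0)" for x
    by (cases "u (\<phi> x)") auto
  have "sum \<phi> {x \<in> X. u (\<phi> x) \<noteq> 0} = (\<Sum>x\<in>X. fun_scale (u (\<phi> x)) (\<phi> x))"
    unfolding scale using fin by (simp add: sum.inter_filter)
  also have "\<dots> = 0"
    using u True by (simp add: sum.reindex)
  finally show ?thesis
    using w by (intro exI[of _ "{x \<in> X. u (\<phi> x) \<noteq> 0}"]) auto
next
  case False
  then obtain x y where "x \<in> X" "y \<in> X" "x \<noteq> y" "\<phi> x = \<phi> y"
    by (auto simp: inj_on_def)
  then show ?thesis
    by (intro exI[of _ "{x, y}"]) (auto simp: fun_bit_add_self)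
qed

text \<open>Extracts all that later arguments use of the representation, so that they need only zero
  sums and the antichain property, no linear algebra.\<close>

lemma binary_matroid_zero_sum:
  assumes "matroid V \<C>" "binary_matroid V \<C>"
  obtains \<phi> :: "'a \<Rightarrow> nat \<Rightarrow> bit"
  where "\<And>C. C \<in> \<C> \<Longrightarrow> sum \<phi> C = 0"
    and "\<And>X. \<lbrakk>X \<subseteq> V; X \<noteq> {}; sum \<phi> X = 0\<rbrakk> \<Longrightarrow> \<exists>C\<in>\<C>. C \<subseteq> X"
proof -
  interpret matroid V \<C> by fact
  obtain \<phi> :: "'a \<Rightarrow> nat \<Rightarrow> bit" where
    \<phi>: "\<And>X. X \<subseteq> V \<Longrightarrow> indep V \<C> X \<longleftrightarrow> inj_on \<phi> X \<and> fun_space.independent (\<phi> ` X)"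
    using assms(2) unfolding binary_matroid_def representable_def by blast
  have contains: "\<exists>C\<in>\<C>. C \<subseteq> X" if "X \<subseteq> V" "X \<noteq> {}" "sum \<phi> X = 0" for X
    using that \<phi>[OF that(1)] zero_sum_not_independent[of X \<phi>] finite_subset[OF _ finite_ground]
    by (auto simp: indep_def)
  have "sum \<phi> C = 0" if C: "C \<in> \<C>" for C
  proof -
    have CV: "C \<subseteq> V" using C circuits_subset by auto
    then have "\<not> (inj_on \<phi> C \<and> fun_space.independent (\<phi> ` C))"
      using C by (subst \<phi>[symmetric]) (auto simp: indep_def)
    \<comment> \<open>The circuit inside \<open>S\<close> lies in \<open>C\<close>, hence equals
      \<open>C\<close> and squeezes \<open>S\<close> to \<open>C\<close>.\<close>
    then obtain S where S: "S \<subseteq> C" "S \<noteq> {}" "sum \<phi> S = 0"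
      using dependent_zero_sum_subset finite_subset[OF CV finite_ground] by blast
    then obtain D where D: "D \<in> \<C>" "D \<subseteq> S"
      using contains CV by blast
    then have "D = C" using C S circuit_antichain by blast
    with S D show ?thesis by auto
  qed
  with contains show thesis using that by blast
qed

section \<open>Circuits of simple binary matroids\<close>

lemma simple_matroid_circuit_card:
  assumes "matroid V \<C>" "simple_matroid V \<C>" "C \<in> \<C>"
  shows "3 \<le> card C"
proof (rule ccontr)
  interpret matroid V \<C> by fact
  have C: "C \<subseteq> V" "C \<noteq> {}" "finite C"
    using assms(3) circuits_subset empty_not_circuit finite_subset[OF _ finite_ground] by auto
  assume "\<not> 3 \<le> card C"
  moreover have "card C \<noteq> 0" using C by simp
  ultimately consider "card C = 1" | "card C = 2" by linarith
  then show False
  proof cases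
    case 1
    then show False
      using assms(2,3) C by (auto simp: card_1_singleton_iff simple_matroid_def loop_def)
  next
    case 2
    then show False
      using assms(2,3) C by (auto simp: card_2_iff simple_matroid_def parallel_def)
  qed
qed

text \<open>Outside \<open>C\<close> the symmetric difference has only the element \<open>v\<close>,
  and it misses the nonempty set \<open>C \<inter> C'\<close>. A circuit in it avoiding
  \<open>v\<close> would thus be a proper subset of \<open>C\<close>, so it cannot be split into two
  zero-sum parts.\<close>

lemma chord_splits_circuit:
  assumes M: "matroid V \<C>" "simple_matroid V \<C>" "binary_matroid V \<C>"
    and C: "C \<in> \<C>" and C': "C' \<in> \<C>" and v: "C' - C = {v}"
  shows "sym_diff C C' \<in> \<C>"
proof -
  interpret matroid V \<C> by fact
  obtain \<phi> :: "'a \<Rightarrow> nat \<Rightarrow> bit"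
    where zero: "\<And>C. C \<in> \<C> \<Longrightarrow> sum \<phi> C = 0"
      and contains: "\<And>X. \<lbrakk>X \<subseteq> V; X \<noteq> {}; sum \<phi> X = 0\<rbrakk> \<Longrightarrow> \<exists>C\<in>\<C>. C \<subseteq> X"
    using binary_matroid_zero_sum[OF M(1,3)] by blast
  have sub: "X \<subseteq> V" "finite X" if "X \<in> \<C>" for X
    using that circuits_subset finite_subset[OF _ finite_ground] by auto
  have "C' \<noteq> {v}"
    using simple_matroid_circuit_card[OF M(1,2) C'] by auto
  then have meet: "C \<inter> C' \<noteq> {}" using v by blast
  have sum: "sum \<phi> (sym_diff C C') = 0"
    using C C' sub zero by (simp add: sum_sym_diff_bit)
  then obtain D where D: "D \<in> \<C>" "D \<subseteq> sym_diff C C'"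
    using contains[of "sym_diff C C'"] sub[OF C] sub[OF C'] v by blast
  have vD: "v \<in> D"
  proof (rule ccontr)
    assume "v \<notin> D"
    then have "D \<subseteq> C" using D(2) v by auto
    then have "D = C" using D C circuit_antichain by blast
    then show False using D meet by blast
  qed
  have "sym_diff C C' - D = {}"
  proof (rule ccontr)
    assume "sym_diff C C' - D \<noteq> {}"
    \<comment> \<open>Removing a zero-sum subset from a zero-sum set leaves sum zero.\<close>
    moreover have "sum \<phi> (sym_diff C C' - D) = 0"
      using sum.subset_diff[OF D(2), of \<phi>] sum zero[OF D(1)] sub(2)[OF C] sub(2)[OF C'] by simp
    ultimately obtain E where E: "E \<in> \<C>" "E \<subseteq> sym_diff C C' - D"
      using contains[of "sym_diff C C' - D"] sub[OF C] sub[OF C'] by blast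
    then have "E \<subseteq> C" using v vD by auto
    then have "E = C" using E C circuit_antichain by blast
    then show False using E meet by blast
  qed
  with D show ?thesis by (metis Diff_eq_empty_iff subset_antisym)
qed

text \<open>As \<open>v\<close> is in both sets, the combination contains their symmetric
  difference, which contains a circuit; the antichain property makes all three equal.\<close>

lemma combination_eq_sym_diff:
  assumes M: "matroid V \<C>" "binary_matroid V \<C>"
    and X: "X\<^sub>1 \<in> \<C>" "X\<^sub>2 \<in> \<C>" "X\<^sub>1 \<noteq> X\<^sub>2" "v \<in> X\<^sub>1 \<inter> X\<^sub>2" "(X\<^sub>1 \<union> X\<^sub>2) - {v} \<in> \<C>"
  shows "(X\<^sub>1 \<union> X\<^sub>2) - {v} = sym_diff X\<^sub>1 X\<^sub>2"
proof -
  interpret matroid V \<C> by fact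
  obtain \<phi> :: "'a \<Rightarrow> nat \<Rightarrow> bit"
    where zero: "\<And>C. C \<in> \<C> \<Longrightarrow> sum \<phi> C = 0"
      and contains: "\<And>X. \<lbrakk>X \<subseteq> V; X \<noteq> {}; sum \<phi> X = 0\<rbrakk> \<Longrightarrow> \<exists>C\<in>\<C>. C \<subseteq> X"
    using binary_matroid_zero_sum[OF M] by blast
  have sub: "X \<subseteq> V" "finite X" if "X \<in> \<C>" for X
    using that circuits_subset finite_subset[OF _ finite_ground] by auto
  have "sum \<phi> (sym_diff X\<^sub>1 X\<^sub>2) = 0"
    using X sub zero by (simp add: sum_sym_diff_bit)
  then obtain E where E: "E \<in> \<C>" "E \<subseteq> sym_diff X\<^sub>1 X\<^sub>2"
    using contains[of "sym_diff X\<^sub>1 X\<^sub>2"] sub[OF X(1)] sub[OF X(2)] X(3) by blast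
  then have "E = (X\<^sub>1 \<union> X\<^sub>2) - {v}"
    using X by (intro circuit_antichain) auto
  then show ?thesis using E X by blast
qed

lemma combination_not_chordless:
  assumes M: "matroid V \<C>" "simple_matroid V \<C>" "binary_matroid V \<C>"
    and X: "X\<^sub>1 \<in> \<C>" "X\<^sub>2 \<in> \<C>" "X\<^sub>1 \<noteq> X\<^sub>2" "v \<in> X\<^sub>1 \<inter> X\<^sub>2"
  shows "\<not> chordless \<C> ((X\<^sub>1 \<union> X\<^sub>2) - {v})"
proof
  interpret matroid V \<C> by fact
  let ?X = "(X\<^sub>1 \<union> X\<^sub>2) - {v}"
  assume ch: "chordless \<C> ?X"
  then have "?X \<in> \<C>" by (simp add: chordless_def)
  then have eq: "?X = sym_diff X\<^sub>1 X\<^sub>2"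
    using combination_eq_sym_diff[OF M(1,3) X] by blast
  have fin: "finite X\<^sub>1" "finite X\<^sub>2"
    using X circuits_subset finite_subset[OF _ finite_ground] by auto
  have "X\<^sub>1 \<inter> X\<^sub>2 = {v}" using eq X by blast
  then have "card (X\<^sub>1 \<union> X\<^sub>2) + 1 = card X\<^sub>1 + card X\<^sub>2"
    using card_Un_Int[OF fin] by simp
  moreover have "card ?X = card (X\<^sub>1 \<union> X\<^sub>2) - 1"
    using X by (intro card_Diff_singleton) auto
  \<comment> \<open>The combination has \<open>card X\<^sub>1 + card X\<^sub>2 - 2\<close> elements,
    and \<open>X\<^sub>2\<close> has at least 3.\<close>
  ultimately have "card X\<^sub>1 < card ?X"
    using simple_matroid_circuit_card[OF M(1,2) X(2)] by linarith
  moreover have "X\<^sub>1 - ?X = {v}" using X by blast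
  ultimately show False using ch X by (auto simp: chordless_def)
qed

text \<open>The witness against chordlessness and its symmetric difference with \<open>C\<close>
  serve as the two parts. That both are smaller than \<open>C\<close> is what makes induction on
  cardinality possible.\<close>

lemma not_chordless_decomposition:
  assumes M: "matroid V \<C>" "simple_matroid V \<C>" "binary_matroid V \<C>"
    and C: "C \<in> \<C>" "\<not> chordless \<C> C"
  obtains X\<^sub>1 X\<^sub>2 v where "X\<^sub>1 \<in> \<C>" "X\<^sub>2 \<in> \<C>" "X\<^sub>1 \<noteq> X\<^sub>2" "v \<in> X\<^sub>1 \<inter> X\<^sub>2"
    "C = (X\<^sub>1 \<union> X\<^sub>2) - {v}" "card X\<^sub>1 < card C" "card X\<^sub>2 < card C"
proof -
  interpret matroid V \<C> by fact
  obtain C' where C': "C' \<in> \<C>" "card (C' - C) = 1" "card C' < card C"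
    using C by (auto simp: chordless_def)
  then obtain v where v: "C' - C = {v}" by (auto simp: card_1_singleton_iff)
  let ?D = "sym_diff C C'"
  have D: "?D \<in> \<C>" by (rule chord_splits_circuit[OF M C(1) C'(1) v])
  have ge: "3 \<le> card C'" by (rule simple_matroid_circuit_card[OF M(1,2) C'(1)])
  have fin: "finite C" "finite C'"
    using C C' circuits_subset finite_subset[OF _ finite_ground] by auto
  have "card C' = card (C \<inter> C') + 1"
    using card_Int_Diff[OF fin(2), of C] C'(2) by (simp add: Int_commute)
  moreover have "card C = card (C \<inter> C') + card (C - C')"
    by (rule card_Int_Diff[OF fin(1)])
  moreover have "card ?D = card (C - C') + card (C' - C)"
    using fin by (intro card_Un_disjoint) auto
  \<comment> \<open>Passing from \<open>C\<close> to \<open>?D\<close> removes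
    \<open>card C' - 1\<close>, so at least 2, elements and adds one.\<close>
  ultimately have less: "card ?D < card C"
    using ge C'(2) by linarith
  have "C' \<noteq> {v}" using ge by auto
  \<comment> \<open>An element of \<open>C'\<close> other than \<open>v\<close> lies in
    \<open>C\<close>, hence not in \<open>?D\<close>.\<close>
  then have "C' \<noteq> ?D" using v by blast
  moreover have "v \<in> C' \<inter> ?D" "C = (C' \<union> ?D) - {v}" using v by blast+
  ultimately show thesis using that[OF C'(1) D] C'(3) less by blast
qed

section \<open>Generators\<close>

text \<open>Stabilization guarantees that the exponent picked by \<open>LEAST\<close> satisfies its
  defining equation.\<close>

lemma generated_fixpoint:
  assumes "finite \<F>" "\<G> \<subseteq> \<F>"
  shows "gen_step \<F> (generated \<F> \<G>) = generated \<F> \<G>"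
  using LeastI_ex[OF gen_step_stabilizes[OF assms]] by (simp add: generated_def)

lemma gen_step_funpow_superset: "\<G> \<subseteq> (gen_step \<F> ^^ n) \<G>"
  by (induction n) (auto simp: gen_step_def)

lemma gen_step_funpow_subset: "\<G> \<subseteq> \<F> \<Longrightarrow> (gen_step \<F> ^^ n) \<G> \<subseteq> \<F>"
  by (induction n) (auto simp: gen_step_def)

lemma generator_chordless:
  assumes M: "matroid V \<C>" "simple_matroid V \<C>" "binary_matroid V \<C>"
  shows "generator \<C> {C. chordless \<C> C}"
proof -
  interpret matroid V \<C> by fact
  let ?K = "{C. chordless \<C> C}"
  have sub: "?K \<subseteq> \<C>" by (auto simp: chordless_def)
  have fin: "finite \<C>" using circuits_subset finite_ground by (auto intro: finite_subset)
  have "C \<in> generated \<C> ?K" if "C \<in> \<C>" for C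
    using that
  proof (induction "card C" arbitrary: C rule: less_induct)
    case less
    show ?case
    proof (cases "chordless \<C> C")
      case True
      then show ?thesis using gen_step_funpow_superset[of ?K] by (auto simp: generated_def)
    next
      case False
      obtain X\<^sub>1 X\<^sub>2 v where X: "X\<^sub>1 \<in> \<C>" "X\<^sub>2 \<in> \<C>" "X\<^sub>1 \<noteq> X\<^sub>2" "v \<in> X\<^sub>1 \<inter> X\<^sub>2"
        "C = (X\<^sub>1 \<union> X\<^sub>2) - {v}" "card X\<^sub>1 < card C" "card X\<^sub>2 < card C"
        using not_chordless_decomposition[OF M less.prems False] by blast
      then have "X\<^sub>1 \<in> generated \<C> ?K" "X\<^sub>2 \<in> generated \<C> ?K"
        using less.hyps by blast+
      \<comment> \<open>One more step applied to the two smaller circuits yields \<open>C\<close>,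
        and the closure absorbs that step.\<close>
      then have "C \<in> gen_step \<C> (generated \<C> ?K)"
        using X less.prems unfolding gen_step_def by blast
      then show ?thesis using generated_fixpoint[OF fin sub] by simp
    qed
  qed
  moreover have "generated \<C> ?K \<subseteq> \<C>"
    unfolding generated_def by (rule gen_step_funpow_subset[OF sub])
  ultimately show ?thesis using sub by (auto simp: generator_def)
qed

text \<open>No step can create a chordless circuit, so one present at any stage of the iteration was
  there at stage 0.\<close>

lemma chordless_in_generator:
  assumes M: "matroid V \<C>" "simple_matroid V \<C>" "binary_matroid V \<C>"
    and gen: "generator \<C> \<G>" and C: "chordless \<C> C"
  shows "C \<in> \<G>"
proof -
  have sub: "\<G> \<subseteq> \<C>" and all: "generated \<C> \<G> = \<C>"
    using gen by (auto simp: generator_def)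
  have "C \<in> \<G>" if "C \<in> (gen_step \<C> ^^ n) \<G>" for n
    using that
  proof (induction n)
    case (Suc n)
    then show ?case
      using combination_not_chordless[OF M] C gen_step_funpow_subset[OF sub, of n]
      unfolding gen_step_def funpow.simps o_apply by blast
  qed simp
  moreover have "C \<in> generated \<C> \<G>"
    using C all by (simp add: chordless_def)
  ultimately show ?thesis by (auto simp: generated_def)
qed

theorem theorem16:
  fixes V :: "'a set" and \<C> :: "'a set set" and \<G> :: "'a set set"
  assumes "matroid V \<C>"
    and "simple_matroid V \<C>"
    and "binary_matroid V \<C>"
  shows "is_arg_min card (generator \<C>) \<G> \<longleftrightarrow> \<G> = {C. chordless \<C> C}"
proof -
  interpret matroid V \<C> by fact
  let ?K = "{C. chordless \<C> C}"
  have K: "generator \<C> ?K" by (rule generator_chordless[OF assms])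
  \<comment> \<open>Containment in every generator gives both minimality and uniqueness, since
    finite sets with \<open>?K \<subseteq> \<G>\<close> and \<open>card \<G> \<le> card ?K\<close>
    coincide.\<close>
  have K_sub: "?K \<subseteq> \<H>" if "generator \<C> \<H>" for \<H>
    using chordless_in_generator[OF assms that] by blast
  have "finite \<C>" using circuits_subset finite_ground by (auto intro: finite_subset)
  then have fin: "finite \<H>" if "generator \<C> \<H>" for \<H>
    using that by (auto simp: generator_def intro: finite_subset)
  show ?thesis
  proof
    assume "is_arg_min card (generator \<C>) \<G>"
    then have \<G>: "generator \<C> \<G>" and "\<not> card ?K < card \<G>"
      using K by (auto simp: is_arg_min_def)
    then show "\<G> = ?K"
      using card_seteq[OF fin[OF \<G>] K_sub[OF \<G>]] by simp
  next
    assume "\<G> = ?K"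
    then show "is_arg_min card (generator \<C>) \<G>"
      using K card_mono[OF fin K_sub] by (auto simp: is_arg_min_def not_less)
  qed
qed

end
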